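(* For every $\epsilon>0$ there is a constant $c_\epsilon>0$ such that for each $R>1$ and each $T\in[1,R]$, there are a nonzero function $f\in L^2(\mathbb Cone^2)$ and a disjoint union of unit balls $X\subset B(0,R)\subset\mathbb R^3$ satisfying \[ |X\cap B(x,r)|\lesssim r,\qquad x\in\mathbb R^3,\ r>1, \] such that $\mathbf P(X)\sim T$, where \[ \mathbf P(X)=\sup\{|X\cap P| : P \text{ is a } 1\times R^{1/2}\times R\text{-lightplank}\}, \] and \[ \int_X|E_{\mathbb Cone^2}f|^2\,dx\ \ge\ c_\epsilon R^{-\epsilon}\,T^{1/2}\,\|f\|_{L^2(d\sigma)}^2 . \]
   Context: $\mathbb Cone^2=\{(\bar\xi,\xi_3)\in\mathbb R^2\times\mathbb R: 1<|\bar\xi|<2,\ \xi_3=|\bar\xi|\}$, with surface measure $d\sigma$; $L^2(\mathbb Cone^2)=L^2(d\sigma)$. The Fourier extension operator is $E_{\mathbb Cone^2}f(x)=\int_{\mathbb Cone^2}f(\xi)e^{2\pi i x\cdot\xi}\,d\sigma(\xi)$, $x\in\mathbb R^3$. $|\cdot|$ is Lebesgue measure. $A\lesssim B$ means $A\le KB$ for an absolute constant $K$, and $A\sim B$ means $A\lesssim B$ and $B\lesssim A$; the constants are independent of $R$ and $T$. Let $\gamma(\theta)=\frac1{\sqrt2}(\cos\theta,\sin\theta,1)$, $\theta\in\mathbb R$. A $1\times R^{1/2}\times R$-lightplank is a set of the form $P=v+\{a\gamma(\theta)+b\gamma'(\theta)+c(\gamma\times\gamma')(\theta): |a|\le \frac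 R2,\ |b|\le\frac{R^{1/2}}2,\ |c|\le\frac12\}$ for some $\theta\in\mathbb R$, $v\in\mathbb R^3$. *)

theory Defs
  imports "HOL-Analysis.Analysis"
begin

unbundle cross3_syntax

definition planar_part :: "real^3 \<Rightarrow> real^2" where
  "planar_part \<xi> = vector [\<xi> $ 1, \<xi> $ 2]"

definition Cone2 :: "(real^3) set" where
  "Cone2 = {\<xi>. 1 < norm (planar_part \<xi>) \<and> norm (planar_part \<xi>) < 2 \<and> \<xi> $ 3 = norm (planar_part \<xi>)}"

definition annulus :: "(real^2) set" where
  "annulus = {\<eta>. 1 < norm \<eta> \<and> norm \<eta> < 2}"

definition cone_graph :: "real^2 \<Rightarrow> real^3" where
  "cone_graph \<eta> = vector [\<eta> $ 1, \<eta> $ 2, norm \<eta>]"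

(* Surface measure of the graph of h(eta) = |eta| over the annulus: the area element is
   sqrt (1 + |grad h|^2) d eta = sqrt 2 d eta.  It is a measure on the space Cone2 itself,
   so integrals and almost-everywhere statements w.r.t. it range over Cone2 only. *)
definition cone_measure :: "(real^3) measure" where
  "cone_measure =
     distr (density (restrict_space lborel annulus) (\<lambda>_. ennreal (sqrt 2)))
       (restrict_space borel Cone2) cone_graph"

definition in_L2_cone :: "(real^3 \<Rightarrow> complex) \<Rightarrow> bool" where
  "in_L2_cone f \<longleftrightarrow>
     f \<in> borel_measurable cone_measure \<and> integrable cone_measure (\<lambda>\<xi>. (cmod (f \<xi>))\<^sup>2)"

definition L2_norm_cone :: "(real^3 \<Rightarrow> complex) \<Rightarrow> real" where
  "L2_norm_cone f = sqrt (\<integral>\<xi>. (cmod (f \<xi>))\<^sup>2 \<partial>cone_measure)"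

definition extension_cone :: "(real^3 \<Rightarrow> complex) \<Rightarrow> real^3 \<Rightarrow> complex" where
  "extension_cone f x =
     (\<integral>\<xi>. f \<xi> * exp (2 * complex_of_real pi * \<i> * complex_of_real (x \<bullet> \<xi>)) \<partial>cone_measure)"

definition light_dir :: "real \<Rightarrow> real^3" where
  "light_dir \<theta> = (1 / sqrt 2) *\<^sub>R vector [cos \<theta>, sin \<theta>, 1]"

definition light_dir' :: "real \<Rightarrow> real^3" where
  "light_dir' \<theta> = vector_derivative light_dir (at \<theta>)"

definition lightplank :: "real \<Rightarrow> real \<Rightarrow> real^3 \<Rightarrow> (real^3) set" where
  "lightplank R \<theta> v =
     {v + a *\<^sub>R light_dir \<theta> + b *\<^sub>R light_dir' \<theta> + c *\<^sub>R (light_dir \<theta> \<times> light_dir' \<theta>) | a b c.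
        \<bar>a\<bar> \<le> R / 2 \<and> \<bar>b\<bar> \<le> sqrt R / 2 \<and> \<bar>c\<bar> \<le> 1 / 2}"

definition plank_sup :: "real \<Rightarrow> (real^3) set \<Rightarrow> ennreal" where
  "plank_sup R X = (SUP P \<in> {lightplank R \<theta> v | \<theta> v. True}. emeasure lebesgue (X \<inter> P))"

definition disjoint_union_of_unit_balls :: "(real^3) set \<Rightarrow> bool" where
  "disjoint_union_of_unit_balls X \<longleftrightarrow>
     (\<exists>C. disjoint_family_on (\<lambda>c. ball c 1) C \<and> X = (\<Union>c\<in>C. ball c 1))"

lemma planar_part_cone_graph: "planar_part (cone_graph \<eta>) = \<eta>"
  by (simp add: planar_part_def cone_graph_def vec_eq_iff forall_2)

lemma cone_graph_annulus: "cone_graph ` annulus = Cone2"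
proof
  show "cone_graph ` annulus \<subseteq> Cone2"
    by (auto simp: Cone2_def annulus_def planar_part_cone_graph) (simp_all add: cone_graph_def)
  show "Cone2 \<subseteq> cone_graph ` annulus"
  proof
    fix \<xi> assume "\<xi> \<in> Cone2"
    then have "\<xi> = cone_graph (planar_part \<xi>)" "planar_part \<xi> \<in> annulus"
      by (auto simp: Cone2_def annulus_def cone_graph_def vec_eq_iff forall_3)
         (simp_all add: planar_part_def)
    then show "\<xi> \<in> cone_graph ` annulus" by blast
  qed
qed

lemma cone_graph_measurable:
  "cone_graph \<in> measurable (density (restrict_space lborel annulus) (\<lambda>_. ennreal (sqrt 2)))
     (restrict_space borel Cone2)"
proof -
  have "continuous_on UNIV (\<lambda>\<eta>. cone_graph \<eta> $ i)" for i
  proof -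
    consider "i = 1" | "i = 2" | "i = 3" using exhaust_3 by blast
    then show ?thesis
      by cases (simp_all add: cone_graph_def, (intro continuous_intros)+)
  qed
  then have "continuous_on UNIV cone_graph"
    using continuous_on_vec_lambda[of UNIV "\<lambda>i \<eta>. cone_graph \<eta> $ i"] by simp
  then have "cone_graph \<in> borel_measurable (restrict_space lborel annulus)"
    by (intro measurable_restrict_space1) (simp add: borel_measurable_continuous_onI)
  then show ?thesis
    using cone_graph_annulus
    by (intro measurable_restrict_space2) (auto simp: space_restrict_space)
qed

lemma light_dir'_eq: "light_dir' \<theta> = (1 / sqrt 2) *\<^sub>R vector [- sin \<theta>, cos \<theta>, 0]"
proof -
  have eq: "(1 / sqrt 2) *\<^sub>R (x *\<^sub>R axis 1 1 + y *\<^sub>R axis 2 1 + z *\<^sub>R axis 3 1)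
      = (1 / sqrt 2) *\<^sub>R (vector [x, y, z] :: real^3)" for x y z
    by (simp add: vec_eq_iff forall_3 axis_def)
  have "((\<lambda>t. (1 / sqrt 2) *\<^sub>R (cos t *\<^sub>R axis 1 1 + sin t *\<^sub>R axis 2 1 + 1 *\<^sub>R axis 3 1 :: real^3))
      has_vector_derivative
        (1 / sqrt 2) *\<^sub>R ((- sin \<theta>) *\<^sub>R axis 1 1 + cos \<theta> *\<^sub>R axis 2 1 + 0 *\<^sub>R axis 3 1)) (at \<theta>)"
    by (auto intro!: derivative_eq_intros)
  then have "(light_dir has_vector_derivative (1 / sqrt 2) *\<^sub>R vector [- sin \<theta>, cos \<theta>, 0]) (at \<theta>)"
    unfolding eq light_dir_def [symmetric] by simp
  then show ?thesis
    unfolding light_dir'_def by (rule vector_derivative_at)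
qed

end

theory Submission
  imports Defs
begin

text \<open>
  Knapp example at scale \<open>T\<close>. Let \<open>f\<close> be the indicator of a cap of the cone of angular width
  \<open>s \<sim> T\<^sup>-\<^sup>1\<^sup>/\<^sup>2\<close>, of measure \<open>m \<sim> s\<close>. Along the normal \<open>u\<close> to the cone at the centre of the cap the
  phase satisfies \<open>t \<bar>u \<bullet> \<xi>\<bar> \<lesssim> t s\<^sup>2\<close>, so for \<open>t \<le> T\<close> there is no cancellation and \<open>\<bar>Ef\<bar> \<ge> m / 2\<close>
  near \<open>t u\<close>. Taking for \<open>X\<close> a row of \<open>\<sim> T\<close> unit balls along \<open>u\<close>, which is also the long direction
  of a lightplank, the integral is \<open>\<gtrsim> T m\<^sup>2 \<sim> T\<^sup>1\<^sup>/\<^sup>2 \<parallel>f\<parallel>\<^sup>2\<close>; no power of \<open>R\<close> is lost.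
\<close>

section \<open>Rows of equally spaced balls along a unit vector\<close>

text \<open>Centres two apart keep unit balls disjoint. The radius is a parameter because one row
  serves three times: radius 1 is the set \<open>X\<close>, radius 1/4 is a part of \<open>X\<close>
  that fits into a plank, and radius 1/64 is a part on which the extension is large.\<close>

definition ball_chain :: "'a::euclidean_space \<Rightarrow> nat \<Rightarrow> real \<Rightarrow> 'a set" where
  "ball_chain u n \<rho> = (\<Union>k<n. ball (real (2 * k) *\<^sub>R u) \<rho>)"

lemma dist_chain_centres:
  fixes u :: "'a::real_normed_vector"
  assumes "norm u = 1"
  shows "dist (real (2 * j) *\<^sub>R u) (real (2 * k) *\<^sub>R u) = 2 * \<bar>real j - real k\<bar>"
proof -
  have "real (2 * j) *\<^sub>R u - real (2 * k) *\<^sub>R u = (2 * (real j - real k)) *\<^sub>R u"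
    by (simp add: scaleR_left_diff_distrib right_diff_distrib)
  then show ?thesis
    by (simp only: dist_norm norm_scaleR abs_mult assms mult_1_right abs_numeral)
qed

lemma disjoint_balls_chain:
  fixes u :: "'a::euclidean_space"
  assumes "norm u = 1" "\<rho> \<le> 1" "j \<noteq> k"
  shows "ball (real (2 * j) *\<^sub>R u) \<rho> \<inter> ball (real (2 * k) *\<^sub>R u) \<rho> = {}"
proof (rule disjoint_ballI)
  have "1 \<le> \<bar>real j - real k\<bar>" using \<open>j \<noteq> k\<close> by linarith
  then show "\<rho> + \<rho> \<le> dist (real (2 * j) *\<^sub>R u) (real (2 * k) *\<^sub>R u)"
    unfolding dist_chain_centres[OF assms(1)] using \<open>\<rho> \<le> 1\<close> by argo
qed

lemma disjoint_union_ball_chain: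
  assumes "norm u = 1"
  shows "disjoint_union_of_unit_balls (ball_chain u n 1)"
proof -
  let ?C = "(\<lambda>k. real (2 * k) *\<^sub>R u) ` {..<n}"
  have "disjoint_family_on (\<lambda>c. ball c 1) ?C"
    unfolding disjoint_family_on_def
  proof (intro ballI impI)
    fix c d assume "c \<in> ?C" "d \<in> ?C" "c \<noteq> d"
    then obtain j k where "c = real (2 * j) *\<^sub>R u" "d = real (2 * k) *\<^sub>R u" "j \<noteq> k" by blast
    then show "ball c 1 \<inter> ball d 1 = {}"
      using disjoint_balls_chain[OF assms order_refl] by simp
  qed
  moreover have "ball_chain u n 1 = (\<Union>c\<in>?C. ball c 1)"
    by (simp only: ball_chain_def image_image)
  ultimately show ?thesis
    unfolding disjoint_union_of_unit_balls_def by blast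
qed

lemma emeasure_ball_eq:
  fixes c :: "'a::euclidean_space"
  shows "emeasure lebesgue (ball c \<rho>) = ennreal (measure lebesgue (ball (0::'a) \<rho>))"
proof (cases "\<rho> \<ge> 0")
  case True
  then show ?thesis
    by (simp add: emeasure_ball content_ball)
qed (simp add: ball_empty)

lemma emeasure_ball_chain:
  fixes u :: "'a::euclidean_space"
  assumes "norm u = 1" "\<rho> \<le> 1"
  shows "emeasure lebesgue (ball_chain u n \<rho>) = ennreal (real n * measure lebesgue (ball (0::'a) \<rho>))"
proof -
  have "(\<Sum>k<n. emeasure lebesgue (ball (real (2 * k) *\<^sub>R u) \<rho>))
      = emeasure lebesgue (\<Union>k<n. ball (real (2 * k) *\<^sub>R u) \<rho>)"
    by (rule sum_emeasure)
      (auto simp: disjoint_family_on_def disjoint_balls_chain[OF assms, simplified])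
  then show ?thesis
    by (simp add: ball_chain_def emeasure_ball_eq ennreal_mult ennreal_of_nat_eq_real_of_nat)
qed

lemma ball_chain_lmeasurable: "ball_chain u n \<rho> \<in> lmeasurable"
  unfolding ball_chain_def by (intro fmeasurable.finite_UN) auto

lemma ball_chain_mono: "\<rho> \<le> \<sigma> \<Longrightarrow> ball_chain u n \<rho> \<subseteq> ball_chain u n \<sigma>"
  unfolding ball_chain_def by (intro UN_mono subset_ball) auto

lemma ball_chain_subset_ball:
  assumes "norm u = 1" "n \<ge> 1" "2 * (real n - 1) + \<rho> \<le> R"
  shows "ball_chain u n \<rho> \<subseteq> ball 0 R"
proof
  fix x assume "x \<in> ball_chain u n \<rho>"
  then obtain k where k: "k < n" "dist (real (2 * k) *\<^sub>R u) x < \<rho>"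
    by (auto simp: ball_chain_def)
  have "norm x \<le> norm (real (2 * k) *\<^sub>R u) + norm (x - real (2 * k) *\<^sub>R u)"
    using norm_triangle_ineq[of "real (2 * k) *\<^sub>R u" "x - real (2 * k) *\<^sub>R u"] by simp
  moreover have "norm (real (2 * k) *\<^sub>R u) \<le> 2 * (real n - 1)"
    using assms(1) k(1) by simp
  ultimately show "x \<in> ball 0 R"
    using k(2) assms(3) by (simp add: dist_norm norm_minus_commute)
qed

text \<open>\<open>N\<close> lies in the integer interval from its minimum to its maximum; the
  \<open>+ 1\<close> counts both endpoints.\<close>

lemma card_le_diameter:
  fixes N :: "nat set"
  assumes "finite N" "L \<ge> 0" "\<And>j k. j \<in> N \<Longrightarrow> k \<in> N \<Longrightarrow> \<bar>real j - real k\<bar> \<le> L"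
  shows "real (card N) \<le> L + 1"
proof (cases "N = {}")
  case False
  have "real (Max N) - real (Min N) \<le> L"
    using assms(3)[of "Max N" "Min N"] assms(1) False by simp
  moreover have "card N \<le> card {Min N..Max N}"
    using assms(1) by (intro card_mono) auto
  moreover have "Min N \<le> Max N" using assms(1) False by (simp add: Min_le_iff[of N] )
  ultimately show ?thesis by (simp add: of_nat_diff)
qed (use assms in auto)

text \<open>One-dimensionality of the row: centres of balls meeting \<open>ball x r\<close> are
  within \<open>r + 1\<close> of \<open>x\<close>, so, with spacing 2, their indices differ by at
  most \<open>r + 1\<close>. Hence at most \<open>r + 2\<close> balls are met, and
  \<open>r + 2 \<le> 3 * r\<close> because \<open>r > 1\<close>.\<close>

lemma emeasure_ball_chain_Int_ball:
  fixes u :: "'a::euclidean_space"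
  assumes "norm u = 1" "r > 1"
  shows "emeasure lebesgue (ball_chain u n 1 \<inter> ball x r) \<le> ennreal (3 * measure lebesgue (ball (0::'a) 1) * r)"
proof -
  define N where "N = {k. k < n \<and> ball (real (2 * k) *\<^sub>R u) 1 \<inter> ball x r \<noteq> {}}"
  have fin: "finite N" unfolding N_def by simp
  have near: "dist (real (2 * k) *\<^sub>R u) x < r + 1" if "k \<in> N" for k
  proof -
    obtain y where "dist (real (2 * k) *\<^sub>R u) y < 1" "dist x y < r"
      using \<open>k \<in> N\<close> by (auto simp: N_def)
    then show ?thesis by metric
  qed
  have "real (card N) \<le> (r + 1) + 1"
  proof (rule card_le_diameter[OF fin])
    fix j k assume "j \<in> N" "k \<in> N"
    then have "dist (real (2 * j) *\<^sub>R u) (real (2 * k) *\<^sub>R u) \<le> (r + 1) + (r + 1)"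
      using near[of j] near[of k] by metric
    then show "\<bar>real j - real k\<bar> \<le> r + 1"
      unfolding dist_chain_centres[OF assms(1)] by argo
  qed (use assms in simp)
  then have card: "real (card N) \<le> 3 * r" using assms by linarith
  have "emeasure lebesgue (ball_chain u n 1 \<inter> ball x r)
      \<le> emeasure lebesgue (\<Union>k\<in>N. ball (real (2 * k) *\<^sub>R u) 1)"
    using fin by (intro emeasure_mono sets.finite_UN) (auto simp: ball_chain_def N_def)
  also have "\<dots> \<le> (\<Sum>k\<in>N. emeasure lebesgue (ball (real (2 * k) *\<^sub>R u) 1))"
    using fin by (intro emeasure_subadditive_finite) auto
  also have "\<dots> = ennreal (real (card N) * measure lebesgue (ball (0::'a) 1))"
    by (simp add: emeasure_ball_eq ennreal_mult ennreal_of_nat_eq_real_of_nat)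
  also have "\<dots> \<le> ennreal (3 * measure lebesgue (ball (0::'a) 1) * r)"
    using mult_right_mono[OF card, of "measure lebesgue (ball (0::'a) 1)"] by (intro ennreal_leI) (simp add: mult_ac)
  finally show ?thesis .
qed

section \<open>The normal direction and the plank along it\<close>

text \<open>The normalised gradient of the defining function |(x1, x2)| - x3 of the cone, taken on
  the ray through (1, 0, 1).\<close>

definition normal_dir :: "real^3" where
  "normal_dir = (1 / sqrt 2) *\<^sub>R vector [1, 0, -1]"

lemma norm_normal_dir: "norm normal_dir = 1"
  by (simp add: normal_dir_def norm_vec_def L2_set_def sum_3 power2_eq_square)

lemma normal_dir_components:
  "normal_dir $ 1 = 1 / sqrt 2" "normal_dir $ 2 = 0" "normal_dir $ 3 = - 1 / sqrt 2"
  by (simp_all add: normal_dir_def)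

text \<open>The plank direction at angle \<open>\<pi>\<close> is \<open>- normal_dir\<close>, which is normal to the cone along the ray of angle 0.\<close>

lemma lightplank_pi_I:
  fixes y :: "real^3"
  assumes "\<bar>t\<bar> + \<rho> \<le> R / 2" "norm y < \<rho>" "\<rho> \<le> 1 / 4" "R > 1"
  shows "v + t *\<^sub>R normal_dir + y \<in> lightplank R pi v"
proof -
  \<comment> \<open>Coordinates in the plank frame at angle \<open>pi\<close>. The frame is
    orthogonal, but only its first vector has length 1: the other two have length 1 / sqrt 2, which
    accounts for the factors in \<open>b\<close> and \<open>c\<close>.\<close>
  define a where "a = - t + (y $ 3 - y $ 1) / sqrt 2"
  define b where "b = - sqrt 2 * y $ 2"
  define c where "c = y $ 1 + y $ 3"
  have s: "sqrt 2 * sqrt 2 = 2" "sqrt 2 > 0" "sqrt 2 \<le> 3 / 2"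
    by (simp, simp, rule real_le_lsqrt) (simp_all add: power2_eq_square)
  have eq: "v + t *\<^sub>R normal_dir + y =
     v + a *\<^sub>R light_dir pi + b *\<^sub>R light_dir' pi + c *\<^sub>R (light_dir pi \<times> light_dir' pi)"
    using s unfolding light_dir'_eq
    by (simp add: vec_eq_iff forall_3 light_dir_def normal_dir_def a_def b_def c_def cross3_simps
        field_simps)
  have sumsq: "(y $ 1)\<^sup>2 + (y $ 2)\<^sup>2 + (y $ 3)\<^sup>2 < \<rho>\<^sup>2"
  proof -
    have "(norm y)\<^sup>2 < \<rho>\<^sup>2" using assms(2) by (intro power_strict_mono) auto
    then show ?thesis by (simp add: norm_vec_def L2_set_def sum_3)
  qed
  have rho: "\<rho> > 0" using assms(2) norm_ge_zero[of y] by linarith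
  \<comment> \<open>This is the component of \<open>y\<close> along a unit vector. Squares are used
    since bounding \<open>y $ 1\<close> and \<open>y $ 3\<close> separately would lose a factor sqrt
    2.\<close>
  have "\<bar>(y $ 3 - y $ 1) / sqrt 2\<bar> \<le> \<rho>"
  proof (rule power2_le_imp_le)
    have "((y $ 3 - y $ 1) / sqrt 2)\<^sup>2 = (y $ 3 - y $ 1)\<^sup>2 / 2"
      by (simp add: power_divide)
    also have "\<dots> \<le> (y $ 1)\<^sup>2 + (y $ 3)\<^sup>2"
      using zero_le_power2[of "y $ 3 + y $ 1"] by (simp add: power2_eq_square algebra_simps)
    finally show "\<bar>(y $ 3 - y $ 1) / sqrt 2\<bar>\<^sup>2 \<le> \<rho>\<^sup>2"
      using sumsq zero_le_power2[of "y $ 2"] by (simp only: power2_abs)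
  qed (use rho in simp)
  then have a: "\<bar>a\<bar> \<le> R / 2" using assms(1) unfolding a_def by linarith
  \<comment> \<open>The radius 1/4 is what the thickness allows: two such components add up to less
    than 1/2.\<close>
  have y: "\<bar>y $ i\<bar> < 1 / 4" for i
    using component_le_norm_cart[of y i] assms(2,3) by linarith
  have "\<bar>b\<bar> = sqrt 2 * \<bar>y $ 2\<bar>" by (simp add: b_def abs_mult)
  also have "\<dots> \<le> (3 / 2) * (1 / 4)"
    using s y[of 2] by (intro mult_mono) auto
  also have "\<dots> \<le> sqrt R / 2"
  proof -
    have "1 \<le> sqrt R" using assms(4) by simp
    then show ?thesis by linarith
  qed
  finally have b: "\<bar>b\<bar> \<le> sqrt R / 2" .
  have c: "\<bar>c\<bar> \<le> 1 / 2" using y[of 1] y[of 3] unfolding c_def by linarith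
  show ?thesis unfolding lightplank_def eq using a b c by blast
qed

text \<open>The plank is centred at the midpoint of the row, so the centres are off by at most
  \<open>real n - 1\<close>, which is at most \<open>(R - 1) / 2\<close> and leaves room for the
  radius. Unit balls would be too thick for a plank, hence the radius 1/4.\<close>

lemma ball_chain_subset_lightplank:
  assumes "R > 1" "2 * (real n - 1) + 1 \<le> R" "n \<ge> 1"
  shows "ball_chain normal_dir n (1 / 4) \<subseteq> lightplank R pi ((real n - 1) *\<^sub>R normal_dir)"
proof
  fix x assume "x \<in> ball_chain normal_dir n (1 / 4)"
  then obtain k where k: "k < n" "norm (x - real (2 * k) *\<^sub>R normal_dir) < 1 / 4"
    by (auto simp: ball_chain_def dist_norm norm_minus_commute)
  define t where "t = real (2 * k) - (real n - 1)"
  have "\<bar>t\<bar> + 1 / 4 \<le> R / 2"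
  proof -
    have "- (real n - 1) \<le> t" "t \<le> real n - 1" using k(1) unfolding t_def by linarith+
    then show ?thesis using assms(2) by argo
  qed
  then have "(real n - 1) *\<^sub>R normal_dir + t *\<^sub>R normal_dir + (x - real (2 * k) *\<^sub>R normal_dir)
      \<in> lightplank R pi ((real n - 1) *\<^sub>R normal_dir)"
    using k(2) assms(1) by (intro lightplank_pi_I[where \<rho> = "1 / 4"]) auto
  then show "x \<in> lightplank R pi ((real n - 1) *\<^sub>R normal_dir)"
    by (simp add: t_def algebra_simps)
qed

text \<open>A plank is the continuous image of a compact box. Measurability is needed to bound
  \<open>plank_sup\<close> from below by monotonicity.\<close>

lemma lightplank_sets: "lightplank R \<theta> v \<in> sets lebesgue"
proof -
  let ?g = "\<lambda>(a, b, c). v + a *\<^sub>R light_dir \<theta> + b *\<^sub>R light_dir' \<theta> + c *\<^sub>R (light_dir \<theta> \<times> light_dir' \<theta>)"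
  have "lightplank R \<theta> v = ?g ` (cbox (- (R / 2), - (sqrt R / 2), - (1 / 2)) (R / 2, sqrt R / 2, 1 / 2))"
    unfolding lightplank_def abs_le_iff by (force simp: image_iff cbox_Pair_eq)
  moreover have "compact \<dots>"
    by (intro compact_continuous_image compact_cbox)
      (auto simp: case_prod_unfold intro!: continuous_intros)
  ultimately show ?thesis by (simp add: compact_imp_closed borel_closed)
qed

section \<open>The surface measure, computed in the parameter plane\<close>

lemma space_cone_measure: "space cone_measure = Cone2"
  by (simp add: cone_measure_def space_restrict_space)

lemma sets_cone_measure: "sets cone_measure = sets (restrict_space borel Cone2)"
  by (simp add: cone_measure_def)

lemma id_measurable_cone: "(\<lambda>\<xi>. \<xi>) \<in> borel_measurable cone_measure"
  unfolding measurable_cong_sets[OF sets_cone_measure refl] by (intro measurable_restrict_space1) simp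

lemma annulus_sets: "annulus \<in> sets lborel"
proof -
  have "annulus = {\<eta>. 1 < norm \<eta>} \<inter> {\<eta>. norm \<eta> < 2}" by (auto simp: annulus_def)
  moreover have "open \<dots>" by (intro open_Int open_Collect_less continuous_intros)
  ultimately show ?thesis by simp
qed

lemma emeasure_cone_measure:
  assumes "A \<in> sets cone_measure"
  shows "emeasure cone_measure A = ennreal (sqrt 2) * emeasure lborel (cone_graph -` A \<inter> annulus)"
proof -
  let ?M = "density (restrict_space lborel annulus) (\<lambda>_. ennreal (sqrt 2))"
  have sp: "space ?M = annulus" by (simp add: space_restrict_space)
  have "A \<in> sets (restrict_space borel Cone2)" using assms sets_cone_measure by simp
  then have m: "cone_graph -` A \<inter> annulus \<in> sets ?M"
    using measurable_sets[OF cone_graph_measurable] sp by metis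
  have "emeasure cone_measure A = emeasure ?M (cone_graph -` A \<inter> annulus)"
    unfolding cone_measure_def using assms
    by (subst emeasure_distr[OF cone_graph_measurable]) (simp_all add: sets_cone_measure sp[simplified])
  also have "\<dots> = ennreal (sqrt 2) * emeasure (restrict_space lborel annulus) (cone_graph -` A \<inter> annulus)"
    using m by (simp add: emeasure_density_const)
  also have "emeasure (restrict_space lborel annulus) (cone_graph -` A \<inter> annulus)
      = emeasure lborel (cone_graph -` A \<inter> annulus)"
    using annulus_sets by (intro emeasure_restrict_space) auto
  finally show ?thesis .
qed

lemma finite_cone_measure: "finite_measure cone_measure"
proof
  have "emeasure lborel (cone_graph -` Cone2 \<inter> annulus) \<le> emeasure lborel (ball (0::real^2) 2)"
    by (intro emeasure_mono) (auto simp: annulus_def)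
  also have "\<dots> < \<infinity>" using emeasure_lborel_ball_finite[of 0 2] by simp
  finally show "emeasure cone_measure (space cone_measure) \<noteq> \<infinity>"
    using emeasure_cone_measure[OF sets.top]
    by (simp add: space_cone_measure ennreal_mult_eq_top_iff less_top)
qed

section \<open>The cap and its measure\<close>

text \<open>A cap around the ray of angle 0, cut out by a rectangle in the parameter plane. The
  bounds 6/5 and 3/2 keep the rectangle inside the annulus for all
  \<open>s \<le> 1 / 8\<close>.\<close>

definition cone_cap :: "real \<Rightarrow> (real^3) set" where
  "cone_cap s = {\<xi> \<in> Cone2. 6 / 5 \<le> \<xi> $ 1 \<and> \<xi> $ 1 \<le> 3 / 2 \<and> \<bar>\<xi> $ 2\<bar> \<le> s}"

lemma cone_cap_sets: "cone_cap s \<in> sets cone_measure"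
proof -
  have [measurable]: "(\<lambda>\<xi>. \<xi>) \<in> borel_measurable cone_measure" by (rule id_measurable_cone)
  have [measurable]: "(\<lambda>\<xi>. \<xi> $ i) \<in> borel_measurable cone_measure" for i
    by (rule borel_measurable_continuous_on[OF _ id_measurable_cone]) (intro continuous_intros)
  have "{\<xi> \<in> space cone_measure. 6 / 5 \<le> \<xi> $ 1 \<and> \<xi> $ 1 \<le> 3 / 2 \<and> \<bar>\<xi> $ 2\<bar> \<le> s} \<in> sets cone_measure"
    by measurable
  then show ?thesis by (simp add: cone_cap_def space_cone_measure)
qed

lemma norm_real2: "(norm (\<eta> :: real^2))\<^sup>2 = (\<eta> $ 1)\<^sup>2 + (\<eta> $ 2)\<^sup>2"
  by (simp add: norm_vec_def L2_set_def sum_2)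

text \<open>The parameter rectangle has sides 3/10 and \<open>2 * s\<close>; the area factor sqrt 2
  is only used as being at least 1.\<close>

lemma measure_cone_cap_ge:
  assumes "0 \<le> s" "s \<le> 1 / 8"
  shows "measure cone_measure (cone_cap s) \<ge> 3 / 5 * s"
proof -
  interpret finite_measure cone_measure by (rule finite_cone_measure)
  let ?B = "cbox (vector [6 / 5, - s]) (vector [3 / 2, s]) :: (real^2) set"
  have four_eq: "(2::real)\<^sup>2 = 4" by simp
  have sub: "?B \<subseteq> cone_graph -` cone_cap s \<inter> annulus"
  proof
    fix \<eta> assume "\<eta> \<in> ?B"
    then have e: "6 / 5 \<le> \<eta> $ 1" "\<eta> $ 1 \<le> 3 / 2" "\<bar>\<eta> $ 2\<bar> \<le> s"
      by (auto simp: mem_box_cart forall_2)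
    \<comment> \<open>The margins suffice: 36/25 > 1 and 9/4 + 1/64 < 4.\<close>
    have "36 / 25 \<le> (\<eta> $ 1)\<^sup>2" "(\<eta> $ 1)\<^sup>2 \<le> 9 / 4" "(\<eta> $ 2)\<^sup>2 \<le> 1 / 64"
      using power_mono[of "6 / 5" "\<eta> $ 1" 2] power_mono[of "\<eta> $ 1" "3 / 2" 2]
        power_mono[of "\<bar>\<eta> $ 2\<bar>" "1 / 8" 2] e assms by (simp_all add: power_divide)
    moreover have "0 \<le> (\<eta> $ 2)\<^sup>2" by simp
    ultimately have "1 < (norm \<eta>)\<^sup>2" "(norm \<eta>)\<^sup>2 < 4"
      unfolding norm_real2 by linarith+
    then have "1\<^sup>2 < (norm \<eta>)\<^sup>2" "(norm \<eta>)\<^sup>2 < 2\<^sup>2"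
      by (simp_all only: one_power2 four_eq)
    then have n: "\<eta> \<in> annulus"
      unfolding annulus_def by (metis (mono_tags) mem_Collect_eq norm_ge_zero power2_less_imp_less zero_le_numeral)
    then have "cone_graph \<eta> \<in> Cone2" using cone_graph_annulus by blast
    then show "\<eta> \<in> cone_graph -` cone_cap s \<inter> annulus"
      using e n by (simp add: cone_cap_def) (simp add: cone_graph_def)
  qed
  have meas: "cone_graph -` cone_cap s \<inter> annulus \<in> sets lborel"
  proof -
    have "cone_graph -` cone_cap s \<inter> annulus \<in> sets (restrict_space lborel annulus)"
      using measurable_sets[OF cone_graph_measurable, of "cone_cap s"] cone_cap_sets
      by (simp add: sets_cone_measure space_restrict_space)
    then show ?thesis using annulus_sets by (simp add: sets_restrict_space_iff)
  qed
  have B: "measure lborel ?B = 3 / 5 * s"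
    using assms by (subst content_cbox_cart) (auto simp: forall_2 UNIV_2 interval_ne_empty_cart)
  have "emeasure lborel ?B = ennreal (measure lborel ?B)"
    using emeasure_lborel_cbox_finite[of "vector [6 / 5, - s] :: real^2" "vector [3 / 2, s]"]
    by (intro emeasure_eq_ennreal_measure) (simp add: less_top)
  then have "ennreal (3 / 5 * s) = emeasure lborel ?B" by (simp only: B)
  also have "\<dots> \<le> emeasure lborel (cone_graph -` cone_cap s \<inter> annulus)"
    by (rule emeasure_mono[OF sub meas])
  also have "\<dots> \<le> ennreal (sqrt 2) * \<dots>"
    using mult_right_mono[of 1 "ennreal (sqrt 2)"] by simp
  also have "\<dots> = ennreal (measure cone_measure (cone_cap s))"
    by (simp add: emeasure_cone_measure[OF cone_cap_sets, symmetric] emeasure_eq_measure)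
  finally show ?thesis by simp
qed

section \<open>The indicator of the cap and bounds for its extension\<close>

definition cap_fun :: "real \<Rightarrow> real^3 \<Rightarrow> complex" where
  "cap_fun s = indicator (cone_cap s)"

lemma cap_fun_measurable: "cap_fun s \<in> borel_measurable cone_measure"
  unfolding cap_fun_def by (rule borel_measurable_indicator[OF cone_cap_sets])

lemma cap_fun_square: "(cmod (cap_fun s \<xi>))\<^sup>2 = indicator (cone_cap s) \<xi>"
  by (simp add: cap_fun_def indicator_def)

lemma integrable_cone_cap: "integrable cone_measure (indicator (cone_cap s) :: _ \<Rightarrow> real)"
proof -
  interpret finite_measure cone_measure by (rule finite_cone_measure)
  show ?thesis
    using emeasure_finite[of "cone_cap s"]
    by (intro integrable_real_indicator cone_cap_sets) (metis infinity_ennreal_def top.not_eq_extremum)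
qed

lemma in_L2_cap_fun: "in_L2_cone (cap_fun s)"
  unfolding in_L2_cone_def cap_fun_square using cap_fun_measurable integrable_cone_cap by blast

lemma L2_norm_cap_fun: "(L2_norm_cone (cap_fun s))\<^sup>2 = measure cone_measure (cone_cap s)"
  unfolding L2_norm_cone_def cap_fun_square
  using cone_cap_sets sets.sets_into_space[OF cone_cap_sets] by (simp add: Int_absorb2)

lemma cap_fun_nonzero:
  assumes "measure cone_measure (cone_cap s) > 0"
  shows "\<not> (AE \<xi> in cone_measure. cap_fun s \<xi> = 0)"
proof
  assume "AE \<xi> in cone_measure. cap_fun s \<xi> = 0"
  then have "AE \<xi> in cone_measure. \<xi> \<notin> cone_cap s"
    by (rule AE_mp) (simp add: cap_fun_def indicator_def)
  then have "emeasure cone_measure (cone_cap s) = 0"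
    using AE_iff_measurable[OF cone_cap_sets[of s], of "\<lambda>\<xi>. \<xi> \<notin> cone_cap s"]
      sets.sets_into_space[OF cone_cap_sets] by auto
  then show False using assms by (simp add: measure_def)
qed

text \<open>Joint measurability in \<open>x\<close> and \<open>\<xi>\<close> is what makes the
  parameter integral a Borel function of \<open>x\<close>.\<close>

lemma extension_integrand_measurable:
  assumes "f \<in> borel_measurable cone_measure"
  shows "(\<lambda>(x, \<xi>). f \<xi> * exp (2 * complex_of_real pi * \<i> * complex_of_real (x \<bullet> \<xi>)))
    \<in> borel_measurable (borel \<Otimes>\<^sub>M cone_measure)"
proof -
  note assms[measurable] id_measurable_cone[measurable]
  have [measurable]: "(\<lambda>p. snd p) \<in> borel_measurable (borel \<Otimes>\<^sub>M cone_measure)"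
    using measurable_compose[OF measurable_snd id_measurable_cone] .
  have [measurable]: "(\<lambda>p. fst p \<bullet> snd p :: real) \<in> borel_measurable (borel \<Otimes>\<^sub>M cone_measure)"
    by (intro borel_measurable_inner) measurable
  have e: "(\<lambda>p. exp (2 * complex_of_real pi * \<i> * complex_of_real (fst p \<bullet> snd p)))
    \<in> borel_measurable (borel \<Otimes>\<^sub>M cone_measure)"
    by (rule borel_measurable_continuous_on[where f = "\<lambda>t. exp (2 * complex_of_real pi * \<i> * complex_of_real t)"])
      (auto intro!: continuous_intros)
  show ?thesis
    unfolding case_prod_unfold by (intro borel_measurable_times e) measurable
qed

lemma extension_cone_measurable:
  assumes "f \<in> borel_measurable cone_measure"
  shows "extension_cone f \<in> borel_measurable borel"
proof -
  interpret finite_measure cone_measure by (rule finite_cone_measure)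
  show ?thesis
    unfolding extension_cone_def[abs_def]
    by (rule borel_measurable_lebesgue_integral[OF extension_integrand_measurable[OF assms]])
qed

lemma norm_extension_integrand:
  "cmod (cap_fun s \<xi> * exp (2 * complex_of_real pi * \<i> * complex_of_real (x \<bullet> \<xi>)))
    = indicator (cone_cap s) \<xi>"
  unfolding norm_mult norm_exp_eq_Re by (cases "\<xi> \<in> cone_cap s") (simp_all add: cap_fun_def)

lemma integrable_extension_cap_fun:
  "integrable cone_measure (\<lambda>\<xi>. cap_fun s \<xi> * exp (2 * complex_of_real pi * \<i> * complex_of_real (x \<bullet> \<xi>)))"
proof (rule Bochner_Integration.integrable_bound[OF integrable_cone_cap[of s]])
  show "(\<lambda>\<xi>. cap_fun s \<xi> * exp (2 * complex_of_real pi * \<i> * complex_of_real (x \<bullet> \<xi>)))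
      \<in> borel_measurable cone_measure"
    using measurable_compose[OF measurable_Pair1' extension_integrand_measurable[OF cap_fun_measurable], of x]
    by simp
qed (simp only: norm_extension_integrand, simp)

text \<open>The trivial bound; it makes the squared extension integrable over the row of
  balls.\<close>

lemma norm_extension_cap_fun_le: "cmod (extension_cone (cap_fun s) x) \<le> measure cone_measure (cone_cap s)"
proof -
  have "cmod (extension_cone (cap_fun s) x) \<le> (\<integral>\<xi>. indicator (cone_cap s) \<xi> \<partial>cone_measure)"
    unfolding extension_cone_def
    by (rule Bochner_Integration.integral_norm_bound_integral[OF integrable_extension_cap_fun integrable_cone_cap])
      (simp only: norm_extension_integrand order_refl)
  then show ?thesis
    using cone_cap_sets sets.sets_into_space[OF cone_cap_sets] by (simp add: Int_absorb2)
qed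

text \<open>Since pi > 3, the point 1 lies below pi / 3, where the cosine is 1/2.\<close>

lemma cos_ge_half: "\<bar>t\<bar> \<le> 1 \<Longrightarrow> cos t \<ge> 1 / 2" for t :: real
  using cos_monotone_0_pi_le[of "\<bar>t\<bar>" "pi / 3"] pi_gt3 by (simp add: cos_60)

text \<open>No cancellation: with phases of at most one radian, every contribution has real part at
  least 1/2, and the modulus dominates the real part of the integral.\<close>

lemma norm_extension_cap_fun_ge:
  assumes "\<And>\<xi>. \<xi> \<in> cone_cap s \<Longrightarrow> \<bar>2 * pi * (x \<bullet> \<xi>)\<bar> \<le> 1"
  shows "cmod (extension_cone (cap_fun s) x) \<ge> measure cone_measure (cone_cap s) / 2"
proof -
  have "measure cone_measure (cone_cap s) / 2 = (\<integral>\<xi>. indicator (cone_cap s) \<xi> / 2 \<partial>cone_measure)"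
    using cone_cap_sets sets.sets_into_space[OF cone_cap_sets] by (simp add: Int_absorb2)
  also have "\<dots> \<le> (\<integral>\<xi>. Re (cap_fun s \<xi> * exp (2 * complex_of_real pi * \<i> * complex_of_real (x \<bullet> \<xi>))) \<partial>cone_measure)"
  proof (rule integral_mono)
    fix \<xi>
    let ?e = "exp (2 * complex_of_real pi * \<i> * complex_of_real (x \<bullet> \<xi>))"
    have e: "Re ?e = cos (2 * pi * (x \<bullet> \<xi>))"
      by (simp add: Re_exp mult_ac)
    show "indicator (cone_cap s) \<xi> / 2 \<le> Re (cap_fun s \<xi> * ?e)"
    proof (cases "\<xi> \<in> cone_cap s")
      case True
      then have "cap_fun s \<xi> = 1" by (simp add: cap_fun_def)
      then have "Re (cap_fun s \<xi> * ?e) = cos (2 * pi * (x \<bullet> \<xi>))" by (simp only: mult_1_left e)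
      then show ?thesis using cos_ge_half[OF assms[OF True]] True by simp
    qed (simp add: cap_fun_def)
  qed (intro integrable_divide_zero integrable_Re integrable_cone_cap integrable_extension_cap_fun)+
  also have "\<dots> = Re (extension_cone (cap_fun s) x)"
    unfolding extension_cone_def by (rule integral_Re[OF integrable_extension_cap_fun])
  also have "\<dots> \<le> cmod (extension_cone (cap_fun s) x)" by (rule complex_Re_le_cmod)
  finally show ?thesis .
qed

text \<open>The cap leaves its tangent plane only quadratically, so moving \<open>t\<close> along
  the normal costs \<open>t * s\<^sup>2 \<le> 1 / 64\<close>. The remaining displacement of 1/64
  costs at most 3/64.\<close>

lemma cone_cap_phase:
  fixes x :: "real^3"
  assumes "\<xi> \<in> cone_cap s" "0 \<le> t" "t * s\<^sup>2 \<le> 1 / 64" "norm (x - t *\<^sub>R normal_dir) \<le> 1 / 64"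
  shows "\<bar>2 * pi * (x \<bullet> \<xi>)\<bar> \<le> 1"
proof -
  define r where "r = \<xi> $ 3"
  have xi: "6 / 5 \<le> \<xi> $ 1" "\<bar>\<xi> $ 2\<bar> \<le> s" and r: "1 < r" "r < 2" and r_norm: "r = norm (planar_part \<xi>)"
    using assms(1) by (auto simp: cone_cap_def Cone2_def r_def)
  have r2: "r\<^sup>2 = (\<xi> $ 1)\<^sup>2 + (\<xi> $ 2)\<^sup>2"
    unfolding r_norm norm_real2 by (simp add: planar_part_def)
  have x2: "(\<xi> $ 2)\<^sup>2 \<le> s\<^sup>2" using power_mono[OF xi(2) abs_ge_zero, of 2] by simp
  have d0: "\<xi> $ 1 \<le> r"
  proof (rule power2_le_imp_le)
    show "(\<xi> $ 1)\<^sup>2 \<le> r\<^sup>2" unfolding r2 by simp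
  qed (use r in linarith)
  \<comment> \<open>Difference of squares: \<open>r - \<xi> $ 1\<close> is
    \<open>(\<xi> $ 2)\<^sup>2\<close> divided by \<open>r + \<xi> $ 1\<close>, and this divisor is
    at least 1.\<close>
  have "(r - \<xi> $ 1) * 1 \<le> (r - \<xi> $ 1) * (r + \<xi> $ 1)"
    using d0 r xi(1) by (intro mult_left_mono) auto
  also have "\<dots> = (\<xi> $ 2)\<^sup>2" using r2 by (simp add: power2_eq_square algebra_simps)
  finally have d1: "r - \<xi> $ 1 \<le> s\<^sup>2" using x2 by simp
  have nd: "normal_dir \<bullet> \<xi> = - ((r - \<xi> $ 1) / sqrt 2)"
    by (simp add: inner_vec_def sum_3 normal_dir_components r_def field_simps)
  have "\<bar>normal_dir \<bullet> \<xi>\<bar> \<le> (r - \<xi> $ 1)"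
    using d0 unfolding nd by (simp add: divide_le_eq mult_le_cancel_left1)
  then have "\<bar>t * (normal_dir \<bullet> \<xi>)\<bar> \<le> t * s\<^sup>2"
    using d1 assms(2) by (simp add: abs_mult mult_left_mono)
  then have p1: "\<bar>t * (normal_dir \<bullet> \<xi>)\<bar> \<le> 1 / 64" using assms(3) by linarith
  have "(norm \<xi>)\<^sup>2 = 2 * r\<^sup>2"
    unfolding r2 by (simp add: norm_vec_def L2_set_def sum_3 r_def[symmetric] r2)
  also have "\<dots> \<le> 3\<^sup>2" using r power_strict_mono[of r 2 2] by simp
  finally have nxi: "norm \<xi> \<le> 3" by (rule power2_le_imp_le) simp
  have "\<bar>(x - t *\<^sub>R normal_dir) \<bullet> \<xi>\<bar> \<le> norm (x - t *\<^sub>R normal_dir) * norm \<xi>"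
    by (rule Cauchy_Schwarz_ineq2)
  also have "\<dots> \<le> 1 / 64 * 3" using assms(4) nxi by (intro mult_mono) auto
  finally have p2: "\<bar>(x - t *\<^sub>R normal_dir) \<bullet> \<xi>\<bar> \<le> 3 / 64" by simp
  have "x \<bullet> \<xi> = (x - t *\<^sub>R normal_dir) \<bullet> \<xi> + t * (normal_dir \<bullet> \<xi>)"
    by (simp add: inner_diff_left)
  then have "\<bar>x \<bullet> \<xi>\<bar> \<le> 1 / 16" using p1 p2 by linarith
  \<comment> \<open>The two errors sum to 1/16, and pi < 4 brings the phase down to 1/2.\<close>
  then have "(2 * pi) * \<bar>x \<bullet> \<xi>\<bar> \<le> (2 * 4) * (1 / 16)"
    using pi_less_4 by (intro mult_mono) auto
  then show ?thesis by (simp add: abs_mult)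
qed

text \<open>Only the cores of radius 1/64 are kept; there the extension is at least half the cap
  measure, whose square gives the factor 1/4.\<close>

lemma integral_extension_cap_fun_ge:
  assumes "2 * (real n - 1) * s\<^sup>2 \<le> 1 / 64"
  shows "set_lebesgue_integral lebesgue (ball_chain normal_dir n 1) (\<lambda>x. (cmod (extension_cone (cap_fun s) x))\<^sup>2)
    \<ge> real n * measure lebesgue (ball (0::real^3) (1 / 64)) * (measure cone_measure (cone_cap s))\<^sup>2 / 4"
proof -
  let ?m = "measure cone_measure (cone_cap s)"
  let ?X = "ball_chain normal_dir n 1" and ?Y = "ball_chain normal_dir n (1 / 64)"
  let ?E = "\<lambda>x. (cmod (extension_cone (cap_fun s) x))\<^sup>2"
  have "extension_cone (cap_fun s) \<in> borel_measurable lebesgue"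
    using extension_cone_measurable[OF cap_fun_measurable]
    by (intro measurable_completion) simp
  then have E: "?E \<in> borel_measurable lebesgue" by measurable
  have X: "?X \<in> sets lebesgue" "emeasure lebesgue ?X < \<infinity>"
    and Y: "?Y \<in> sets lebesgue" "emeasure lebesgue ?Y < \<infinity>"
    using ball_chain_lmeasurable unfolding fmeasurable_def by blast+
  have iX: "integrable lebesgue (\<lambda>x. indicator ?X x * ?m\<^sup>2)"
    and iY: "integrable lebesgue (\<lambda>x. indicator ?Y x * (?m\<^sup>2 / 4))"
    using X Y by (auto intro!: integrable_mult_left integrable_real_indicator)
  \<comment> \<open>A non-integrable function would have integral 0 by convention, so the comparison
    of integrals below relies on this.\<close>
  have iE: "integrable lebesgue (\<lambda>x. indicator ?X x *\<^sub>R ?E x)"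
  proof (rule Bochner_Integration.integrable_bound[OF iX])
    show "(\<lambda>x. indicator ?X x *\<^sub>R ?E x) \<in> borel_measurable lebesgue"
      by (intro borel_measurable_scaleR borel_measurable_indicator X(1) E)
    have "?E x \<le> ?m\<^sup>2" for x
      by (intro power_mono norm_extension_cap_fun_le norm_ge_zero)
    then show "AE x in lebesgue. norm (indicator ?X x *\<^sub>R ?E x) \<le> norm (indicator ?X x * ?m\<^sup>2)"
      by (intro AE_I2) (simp add: indicator_def)
  qed
  have "?m\<^sup>2 / 4 \<le> ?E x" if "x \<in> ?Y" for x
  proof -
    obtain k where k: "k < n" "norm (x - real (2 * k) *\<^sub>R normal_dir) < 1 / 64"
    proof -
      from \<open>x \<in> ?Y\<close> obtain k where "k < n" "x \<in> ball (real (2 * k) *\<^sub>R normal_dir) (1 / 64)"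
        unfolding ball_chain_def by blast
      then show thesis by (intro that[of k]) (simp_all only: mem_ball dist_norm norm_minus_commute)
    qed
    \<comment> \<open>The farthest centre, at distance \<open>2 * (real n - 1)\<close>, is the worst
      case.\<close>
    have "real (2 * k) * s\<^sup>2 \<le> 2 * (real n - 1) * s\<^sup>2"
      using k(1) by (intro mult_right_mono) auto
    then have "real (2 * k) * s\<^sup>2 \<le> 1 / 64" using assms by linarith
    then have "?m / 2 \<le> cmod (extension_cone (cap_fun s) x)"
      using k(2) by (intro norm_extension_cap_fun_ge cone_cap_phase[of _ s "real (2 * k)"]) simp_all
    then have "(?m / 2)\<^sup>2 \<le> ?E x" by (intro power_mono) auto
    then show ?thesis by (simp add: power_divide)
  qed
  moreover have "?Y \<subseteq> ?X" by (rule ball_chain_mono) simp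
  ultimately have "(\<integral>x. indicator ?Y x * (?m\<^sup>2 / 4) \<partial>lebesgue) \<le> (\<integral>x. indicator ?X x *\<^sub>R ?E x \<partial>lebesgue)"
    by (intro integral_mono[OF iY iE]) (auto simp: indicator_def)
  moreover have "measure lebesgue ?Y = real n * measure lebesgue (ball (0::real^3) (1 / 64))"
    using emeasure_ball_chain[OF norm_normal_dir, of "1 / 64" n] by (simp add: measure_def)
  ultimately show ?thesis
    using Y by (simp add: set_lebesgue_integral_def)
qed

section \<open>Choice of constants and assembly\<close>

theorem theorem3p2:
  shows "\<exists>K::real. K > 0 \<and>
    (\<forall>\<epsilon>::real. \<epsilon> > 0 \<longrightarrow>
      (\<exists>c::real. c > 0 \<and>
        (\<forall>R T :: real. R > 1 \<longrightarrow> T \<in> {1..R} \<longrightarrow>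
          (\<exists>(f :: real^3 \<Rightarrow> complex) (X :: (real^3) set).
              in_L2_cone f \<and>
              \<not> (AE \<xi> in cone_measure. f \<xi> = 0) \<and>
              disjoint_union_of_unit_balls X \<and>
              X \<subseteq> ball 0 R \<and>
              (\<forall>x::real^3. \<forall>r::real. r > 1 \<longrightarrow>
                 emeasure lebesgue (X \<inter> ball x r) \<le> ennreal (K * r)) \<and>
              plank_sup R X \<le> ennreal (K * T) \<and>
              ennreal T \<le> ennreal K * plank_sup R X \<and>
              set_lebesgue_integral lebesgue X (\<lambda>x. (cmod (extension_cone f x))\<^sup>2)
                \<ge> c * R powr (- \<epsilon>) * sqrt T * (L2_norm_cone f)\<^sup>2))))"
proof -
  define V where "V \<rho> = measure lebesgue (ball (0::real^3) \<rho>)" for \<rho>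
  have V: "V \<rho> > 0" if "\<rho> > 0" for \<rho>
    unfolding V_def using content_ball_pos[OF that, of "0::real^3"] by simp
  \<comment> \<open>The first entry serves the density bound and the upper plank bound, the second
    the lower plank bound.\<close>
  define K where "K = max (3 * V 1) (3 / V (1 / 4))"
  have K: "3 * V 1 \<le> K" "3 / V (1 / 4) \<le> K" "K > 0"
    using V[of 1] by (auto simp: K_def less_max_iff_disj)
  \<comment> \<open>160 collects 1/3 from \<open>T / 3 \<le> real n\<close>, 3/5 from the cap
    measure, 1/8 from \<open>T * s = sqrt T / 8\<close>, and 1/4 from the squared half. The constant
    does not depend on \<open>\<epsilon>\<close>.\<close>
  define c where "c = V (1 / 64) / 160"
  have c: "c > 0" unfolding c_def using V by simp
  have main: "\<exists>(f :: real^3 \<Rightarrow> complex) (X :: (real^3) set).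
              in_L2_cone f \<and>
              \<not> (AE \<xi> in cone_measure. f \<xi> = 0) \<and>
              disjoint_union_of_unit_balls X \<and>
              X \<subseteq> ball 0 R \<and>
              (\<forall>x::real^3. \<forall>r::real. r > 1 \<longrightarrow>
                 emeasure lebesgue (X \<inter> ball x r) \<le> ennreal (K * r)) \<and>
              plank_sup R X \<le> ennreal (K * T) \<and>
              ennreal T \<le> ennreal K * plank_sup R X \<and>
              set_lebesgue_integral lebesgue X (\<lambda>x. (cmod (extension_cone f x))\<^sup>2)
                \<ge> c * R powr (- \<epsilon>) * sqrt T * (L2_norm_cone f)\<^sup>2"
    if "\<epsilon> > 0" "R > 1" "T \<in> {1..R}" for \<epsilon> R T :: real
  proof -
    have T: "1 \<le> T" "T \<le> R" using that by auto
    \<comment> \<open>The largest number of balls with \<open>2 * (real n - 1) + 1 \<le> T\<close>;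
      as \<open>T \<le> R\<close>, the row fits both into \<open>ball 0 R\<close> and along a
      plank.\<close>
    define n where "n = nat \<lfloor>(T + 1) / 2\<rfloor>"
    have n: "n \<ge> 1" "real n \<le> (T + 1) / 2" "T / 3 \<le> real n"
    proof -
      have f: "(T + 1) / 2 < of_int \<lfloor>(T + 1) / 2\<rfloor> + 1" "of_int \<lfloor>(T + 1) / 2\<rfloor> \<le> (T + 1) / 2"
        using floor_correct[of "(T + 1) / 2"] by simp_all
      have f3: "1 \<le> \<lfloor>(T + 1) / 2\<rfloor>" using T by (simp add: le_floor_iff)
      have rn: "real n = of_int \<lfloor>(T + 1) / 2\<rfloor>" using f3 unfolding n_def by simp
      have n1: "1 \<le> real n" using f3 unfolding rn by simp
      then show "n \<ge> 1" by simp
      show "real n \<le> (T + 1) / 2" using f(2) rn by simp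
      \<comment> \<open>For \<open>T \<le> 3\<close> this is \<open>real n \<ge> 1\<close>; beyond
        that \<open>(T - 1) / 2 \<ge> T / 3\<close>.\<close>
      show "T / 3 \<le> real n" using f(1) n1 unfolding rn[symmetric] by argo
    qed
    \<comment> \<open>The widest cap whose phase stays controlled up to distance \<open>T\<close>:
      it makes \<open>T * s\<^sup>2\<close> exactly 1/64.\<close>
    define s where "s = 1 / (8 * sqrt T)"
    have s: "0 < s" "s \<le> 1 / 8" "T * s\<^sup>2 = 1 / 64" "T * s = sqrt T / 8"
      using T by (auto simp: s_def field_simps power2_eq_square)
    let ?X = "ball_chain normal_dir n 1" and ?m = "measure cone_measure (cone_cap s)"
    have m: "3 / 5 * s \<le> ?m" using s by (intro measure_cone_cap_ge) auto
    have density: "emeasure lebesgue (?X \<inter> ball x r) \<le> ennreal (K * r)" if "r > 1" for x r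
    proof -
      have "3 * V 1 * r \<le> K * r" using K that by (intro mult_right_mono) auto
      then show ?thesis
        using emeasure_ball_chain_Int_ball[OF norm_normal_dir that, of n x]
        by (auto simp: V_def intro: order_trans ennreal_leI)
    qed
    \<comment> \<open>The whole of \<open>?X\<close> already has measure of order
      \<open>T\<close>.\<close>
    have upper: "plank_sup R ?X \<le> ennreal (K * T)"
      unfolding plank_sup_def
    proof (rule SUP_least)
      fix P
      have "emeasure lebesgue (?X \<inter> P) \<le> emeasure lebesgue ?X"
        using ball_chain_lmeasurable[of normal_dir n 1] by (intro emeasure_mono) (auto simp: fmeasurable_def)
      also have "\<dots> = ennreal (real n * V 1)"
        unfolding V_def by (rule emeasure_ball_chain[OF norm_normal_dir]) simp
      also have "\<dots> \<le> ennreal (K * T)"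
      proof (rule ennreal_leI)
        have "real n * V 1 \<le> T * (3 * V 1)"
          using n T V[of 1] by (intro mult_mono) auto
        also have "\<dots> \<le> T * K" using K T by (intro mult_left_mono) auto
        finally show "real n * V 1 \<le> K * T" by (simp add: mult.commute)
      qed
      finally show "emeasure lebesgue (?X \<inter> P) \<le> ennreal (K * T)" .
    qed
    have lower: "ennreal T \<le> ennreal K * plank_sup R ?X"
    proof -
      let ?P = "lightplank R pi ((real n - 1) *\<^sub>R normal_dir)"
      let ?Y = "ball_chain normal_dir n (1 / 4)"
      have "T = 3 / V (1 / 4) * (T / 3 * V (1 / 4))" using V[of "1 / 4"] by simp
      also have "\<dots> \<le> K * (real n * V (1 / 4))"
        using K n T V[of "1 / 4"] by (intro mult_mono) auto
      finally have "ennreal T \<le> ennreal K * ennreal (real n * V (1 / 4))"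
        using K V[of "1 / 4"] by (simp add: ennreal_mult[symmetric])
      also have "ennreal (real n * V (1 / 4)) = emeasure lebesgue ?Y"
        unfolding V_def by (rule emeasure_ball_chain[OF norm_normal_dir, symmetric]) simp
      also have "\<dots> \<le> emeasure lebesgue (?X \<inter> ?P)"
      proof (rule emeasure_mono)
        show "?Y \<subseteq> ?X \<inter> ?P"
          using ball_chain_subset_lightplank[of R n] ball_chain_mono[of "1 / 4" 1 normal_dir n] n T that
          by auto
        show "?X \<inter> ?P \<in> sets lebesgue"
          using ball_chain_lmeasurable[of normal_dir n 1] lightplank_sets
          by (auto simp: fmeasurable_def)
      qed
      also have "\<dots> \<le> plank_sup R ?X"
        unfolding plank_sup_def by (rule SUP_upper) blast
      finally show ?thesis by (simp add: mult_left_mono)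
    qed
    have bound: "c * R powr (- \<epsilon>) * sqrt T * (L2_norm_cone (cap_fun s))\<^sup>2
        \<le> set_lebesgue_integral lebesgue ?X (\<lambda>x. (cmod (extension_cone (cap_fun s) x))\<^sup>2)"
    proof -
      have "R powr (- \<epsilon>) \<le> 1" using that powr_mono[of "- \<epsilon>" 0 R] by simp
      then have "c * R powr (- \<epsilon>) * sqrt T * ?m \<le> c * 1 * sqrt T * ?m"
        using c T by (intro mult_right_mono mult_left_mono) auto
      \<comment> \<open>Of the two factors \<open>?m\<close> in the integral bound, one is kept as
        the squared norm and the other is estimated by \<open>3 / 5 * s\<close>.\<close>
      also have "\<dots> = T / 3 * V (1 / 64) * (3 / 5 * s * ?m) / 4"
        using s(4) by (simp add: c_def)
      also have "\<dots> \<le> real n * V (1 / 64) * (?m * ?m) / 4"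
        using n m T s V[of "1 / 64"] by (intro divide_right_mono mult_mono mult_nonneg_nonneg) auto
      also have "\<dots> \<le> set_lebesgue_integral lebesgue ?X (\<lambda>x. (cmod (extension_cone (cap_fun s) x))\<^sup>2)"
      proof -
        have "2 * (real n - 1) * s\<^sup>2 \<le> T * s\<^sup>2" using n by (intro mult_right_mono) auto
        then show ?thesis
          using integral_extension_cap_fun_ge[of n s] s(3) by (simp add: V_def power2_eq_square)
      qed
      finally show ?thesis unfolding L2_norm_cap_fun .
    qed
    have "?X \<subseteq> ball 0 R" using n T by (intro ball_chain_subset_ball norm_normal_dir) auto
    moreover have "?m > 0" using s(1) by (intro less_le_trans[OF _ m]) simp
    ultimately show ?thesis
      using density upper lower bound
      by (intro exI[of _ "cap_fun s"] exI[of _ ?X] conjI allI impI in_L2_cap_fun cap_fun_nonzero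
          disjoint_union_ball_chain norm_normal_dir)
  qed
  show ?thesis
    by (rule exI[of _ K], intro conjI allI impI K(3), rule exI[of _ c], intro conjI allI impI c main)
qed

end
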